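(* For every finite $n>0$, the modal algebras $\mathrm{Alg}(\omega^n,\preceq)$ and $\mathrm{Alg}(\omega^n,\prec)$ are locally finite.
   Context: $\omega=\{0,1,2,\dots\}$ is the set of natural numbers, and $\omega^n$ is the set of $n$-tuples $x=(x(i))_{i<n}$ of natural numbers. For $x,y\in\omega^n$: $x\preceq y$ iff $x(i)\le y(i)$ for all $i<n$; $x\prec y$ iff $x(i)<y(i)$ for all $i<n$ (so $\prec$ is the relation of the direct power of $(\omega,<)$, strict in every coordinate, not the strict part of $\preceq$). A (Kripke) frame is a pair $(W,R)$ with $R\subseteq W\times W$. Its (complex) algebra $\mathrm{Alg}(W,R)$ is the modal algebra $(\mathcal{P}(W),R^{-1})$, i.e. the Boolean algebra of all subsets of $W$ equipped with the unary operation $R^{-1}(V)=\{x\in W\mid \exists y\in V\; xRy\}$. An algebra is locally finite if every finitely generated subalgebra of it is finite (subalgebras of a modal algebra are taken with respect to the Boolean operations, including the constants, and the modal operation). *)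

theory Defs
  imports Main "HOL-Library.FuncSet"
begin

record 'a modal_alg =
  elems :: "'a set"
  meet :: "'a \<Rightarrow> 'a \<Rightarrow> 'a"
  join :: "'a \<Rightarrow> 'a \<Rightarrow> 'a"
  compl :: "'a \<Rightarrow> 'a"
  zero :: "'a"
  one :: "'a"
  dia :: "'a \<Rightarrow> 'a"

definition subalgebra :: "'a set \<Rightarrow> 'a modal_alg \<Rightarrow> bool" where
  "subalgebra S A \<longleftrightarrow>
     S \<subseteq> elems A \<and> zero A \<in> S \<and> one A \<in> S \<and>
     (\<forall>x\<in>S. \<forall>y\<in>S. meet A x y \<in> S) \<and>
     (\<forall>x\<in>S. \<forall>y\<in>S. join A x y \<in> S) \<and>
     (\<forall>x\<in>S. compl A x \<in> S) \<and>
     (\<forall>x\<in>S. dia A x \<in> S)"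

definition generated_subalgebra :: "'a modal_alg \<Rightarrow> 'a set \<Rightarrow> 'a set" where
  "generated_subalgebra A G = \<Inter>{S. subalgebra S A \<and> G \<subseteq> S}"

definition finitely_generated :: "'a modal_alg \<Rightarrow> 'a set \<Rightarrow> bool" where
  "finitely_generated A S \<longleftrightarrow>
     (\<exists>G. finite G \<and> G \<subseteq> elems A \<and> S = generated_subalgebra A G)"

definition locally_finite :: "'a modal_alg \<Rightarrow> bool" where
  "locally_finite A \<longleftrightarrow>
     (\<forall>S. subalgebra S A \<and> finitely_generated A S \<longrightarrow> finite S)"

definition Alg :: "'a set \<Rightarrow> 'a rel \<Rightarrow> 'a set modal_alg" where
  "Alg W R =
     \<lparr>elems = Pow W,
      meet = (\<inter>),
      join = (\<union>),
      compl = (\<lambda>V. W - V),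
      zero = {},
      one = W,
      dia = (\<lambda>V. {x \<in> W. \<exists>y\<in>V. (x, y) \<in> R})\<rparr>"

lemma subalgebra_elems_Alg: "subalgebra (elems (Alg W R)) (Alg W R)"
  by (auto simp: subalgebra_def Alg_def)

text \<open>If \<open>G\<close> is not contained in the algebra, \<^const>\<open>generated_subalgebra\<close> is an empty
  intersection; hence the condition \<open>G \<subseteq> elems A\<close> in \<^const>\<open>finitely_generated\<close>
  and in the following lemma.\<close>

lemma subalgebra_generated_Alg:
  assumes "G \<subseteq> Pow W"
  shows "subalgebra (generated_subalgebra (Alg W R) G) (Alg W R)"
proof -
  have "generated_subalgebra (Alg W R) G \<subseteq> elems (Alg W R)"
    using assms subalgebra_elems_Alg[of W R]
    unfolding generated_subalgebra_def by (auto simp: Alg_def)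
  then show ?thesis
    by (simp add: subalgebra_def generated_subalgebra_def)
qed

text \<open>An \<open>n\<close>-tuple is a function that takes the value \<^const>\<open>undefined\<close> outside \<open>{..<n}\<close>,
  so that equality of functions is equality of tuples.\<close>

definition omega_pow :: "nat \<Rightarrow> (nat \<Rightarrow> nat) set" where
  "omega_pow n = {..<n} \<rightarrow>\<^sub>E (UNIV :: nat set)"

definition preceq_rel :: "nat \<Rightarrow> (nat \<Rightarrow> nat) rel" where
  "preceq_rel n = {(x, y) \<in> omega_pow n \<times> omega_pow n. \<forall>i<n. x i \<le> y i}"

text \<open>Strict in every coordinate; this is not the strict part of \<^const>\<open>preceq_rel\<close>.\<close>

definition prec_rel :: "nat \<Rightarrow> (nat \<Rightarrow> nat) rel" where
  "prec_rel n = {(x, y) \<in> omega_pow n \<times> omega_pow n. \<forall>i<n. x i < y i}"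

end

theory Submission
  imports Defs
begin

text \<open>
  A finite family of subsets of a frame amounts to a colouring of its points with finitely many
  colours.  Call a colouring tuned if the set of colours that a point sees along \<open>R\<close> depends
  only on the colour of the point.  The unions of colour classes of a tuned colouring form a
  subalgebra of the complex algebra, and it is finite.  So a frame has a locally finite algebra as
  soon as every finite colouring has a finite tuned refinement (lemma
  \<open>tunable_imp_locally_finite\<close>); such frames are called tunable below.

  To tune a given colouring \<open>f\<close> of \<open>\<omega>\<^sup>n\<close>, note that for a large threshold \<open>m\<close> every colour that
  occurs at all in the corner where all coordinates are at least \<open>m\<close> occurs there cofinally:
  there are finitely many colours, and \<open>m\<close> only has to exceed a bound for each colour that is
  not cofinal.  Restricted to this corner the colouring \<open>f\<close> is already tuned, because each of its
  points sees every colour of the corner, also along the strict relation.  The rest of \<open>\<omega>\<^sup>n\<close> is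
  covered by the pieces \<open>x i < m\<close>, which are products of \<open>\<omega>\<^bsup>n-1\<^esup>\<close> with a finite set and are handled
  by induction on the number of unbounded coordinates.  To make the induction go through, its
  statement is about slabs: sets of tuples in which the coordinates outside a given set are below a
  given bound (lemma \<open>tunable_slab\<close>).

  It remains to glue the pieces.  Coordinates cannot decrease along \<open>R\<close>, so nothing in
  the piece \<open>m \<le> x i\<close> sees the piece \<open>x i < m\<close>.  With such a one-way cut the upper part can be tuned
  first, and then the colouring of the lower part is enriched by the set of upper colours
  that a point sees, before the lower part is tuned (lemma \<open>tuned_refinement_union\<close>).
\<close>

section \<open>Tuned colourings\<close>

definition tuned :: "'a set \<Rightarrow> 'a rel \<Rightarrow> ('a \<Rightarrow> 'c) \<Rightarrow> bool" where
  "tuned W R g \<longleftrightarrow>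
     (\<forall>u\<in>W. \<forall>u'\<in>W. \<forall>v\<in>W. g u = g u' \<longrightarrow> (u, v) \<in> R \<longrightarrow> (\<exists>v'\<in>W. g v' = g v \<and> (u', v') \<in> R))"

text \<open>The colours of the refinement are natural numbers only because a definition cannot quantify
  over types; by \<open>has_tuned_refinementI\<close> and \<open>tunableD\<close> any other type of colours will do.\<close>

definition has_tuned_refinement :: "'a set \<Rightarrow> 'a rel \<Rightarrow> ('a \<Rightarrow> 'c) \<Rightarrow> bool" where
  "has_tuned_refinement W R f \<longleftrightarrow>
     (\<exists>g :: 'a \<Rightarrow> nat. finite (g ` W) \<and> (\<forall>x\<in>W. \<forall>y\<in>W. g x = g y \<longrightarrow> f x = f y) \<and> tuned W R g)"

definition tunable :: "'a set \<Rightarrow> 'a rel \<Rightarrow> bool" where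
  "tunable W R \<longleftrightarrow> (\<forall>f :: 'a \<Rightarrow> nat. finite (f ` W) \<longrightarrow> has_tuned_refinement W R f)"

lemma finite_colouring_as_nat:
  fixes g :: "'a \<Rightarrow> 'b"
  assumes "finite (g ` W)"
  obtains h :: "'a \<Rightarrow> nat"
  where "finite (h ` W)" "\<And>x y. x \<in> W \<Longrightarrow> y \<in> W \<Longrightarrow> h x = h y \<longleftrightarrow> g x = g y"
proof -
  obtain e :: "'b \<Rightarrow> nat" where "inj_on e (g ` W)"
    using finite_imp_inj_to_nat_seg[OF assms] by blast
  then have "\<And>x y. x \<in> W \<Longrightarrow> y \<in> W \<Longrightarrow> (e \<circ> g) x = (e \<circ> g) y \<longleftrightarrow> g x = g y"
    by (auto simp: inj_on_eq_iff)
  moreover have "finite ((e \<circ> g) ` W)"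
    using finite_imageI[OF assms, of e] by (simp add: image_image)
  ultimately show ?thesis
    using that by blast
qed

lemma has_tuned_refinementI:
  fixes g :: "'a \<Rightarrow> 'b"
  assumes "finite (g ` W)" "\<And>x y. x \<in> W \<Longrightarrow> y \<in> W \<Longrightarrow> g x = g y \<Longrightarrow> f x = f y" "tuned W R g"
  shows "has_tuned_refinement W R f"
proof -
  obtain h :: "'a \<Rightarrow> nat" where h: "finite (h ` W)"
    "\<And>x y. x \<in> W \<Longrightarrow> y \<in> W \<Longrightarrow> h x = h y \<longleftrightarrow> g x = g y"
    using finite_colouring_as_nat[OF assms(1)] by blast
  have "tuned W R h"
    unfolding tuned_def
  proof (intro ballI impI)
    fix u u' v assume "u \<in> W" "u' \<in> W" "v \<in> W" "h u = h u'" "(u, v) \<in> R"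
    then obtain v' where "v' \<in> W" "g v' = g v" "(u', v') \<in> R"
      using assms(3) h(2) unfolding tuned_def by blast
    then show "\<exists>v'\<in>W. h v' = h v \<and> (u', v') \<in> R"
      using h(2) \<open>v \<in> W\<close> by blast
  qed
  then show ?thesis
    unfolding has_tuned_refinement_def using h assms(2) by blast
qed

lemma tunableD:
  fixes f :: "'a \<Rightarrow> 'b"
  assumes "tunable W R" "finite (f ` W)"
  shows "has_tuned_refinement W R f"
proof -
  obtain h :: "'a \<Rightarrow> nat" where h: "finite (h ` W)"
    "\<And>x y. x \<in> W \<Longrightarrow> y \<in> W \<Longrightarrow> h x = h y \<longleftrightarrow> f x = f y"
    using finite_colouring_as_nat[OF assms(2)] by blast
  then have "has_tuned_refinement W R h"
    using assms(1) unfolding tunable_def by blast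
  then show ?thesis
    unfolding has_tuned_refinement_def using h(2) by blast
qed

text \<open>A colouring that distinguishes \<open>V\<close> from its complement can only be refined by colourings that
  do so too, and then \<open>V\<close> is a union of colour classes; hence points of one class that
  lies in \<open>V\<close> see the same classes inside \<open>V\<close>.\<close>

lemma tunable_subset:
  assumes "tunable W R" "V \<subseteq> W"
  shows "tunable V R"
  unfolding tunable_def
proof (intro allI impI)
  fix f :: "'a \<Rightarrow> nat" assume fin: "finite (f ` V)"
  define f' where "f' x = (if x \<in> V then Some (f x) else None)" for x
  have "f' ` W \<subseteq> insert None (Some ` f ` V)"
    by (auto simp: f'_def)
  then have "finite (f' ` W)"
    using fin by (meson finite.insertI finite_imageI finite_subset)
  then have "has_tuned_refinement W R f'"
    by (rule tunableD[OF assms(1)])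
  then obtain g :: "'a \<Rightarrow> nat" where g: "finite (g ` W)"
    "\<And>x y. x \<in> W \<Longrightarrow> y \<in> W \<Longrightarrow> g x = g y \<Longrightarrow> f' x = f' y" "tuned W R g"
    unfolding has_tuned_refinement_def by blast
  have sep: "x \<in> V \<and> f x = f y" if "y \<in> V" "x \<in> W" "g x = g y" for x y
    using g(2)[of x y] that assms(2) by (auto simp: f'_def split: if_splits)
  have "tuned V R g"
    unfolding tuned_def
  proof (intro ballI impI)
    fix u u' v assume "u \<in> V" "u' \<in> V" "v \<in> V" "g u = g u'" "(u, v) \<in> R"
    then obtain v' where "v' \<in> W" "g v' = g v" "(u', v') \<in> R"
      using g(3) assms(2) unfolding tuned_def by blast
    then show "\<exists>v'\<in>V. g v' = g v \<and> (u', v') \<in> R"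
      using sep[of v v'] \<open>v \<in> V\<close> by blast
  qed
  moreover have "finite (g ` V)"
    using g(1) assms(2) by (meson finite_subset image_mono)
  ultimately show "has_tuned_refinement V R f"
    using sep assms(2) by (intro has_tuned_refinementI[of g]) blast+
qed

text \<open>The colour of a point of \<open>U\<close> must determine which colours of \<open>V\<close> the point sees.  As no point
  of \<open>V\<close> sees \<open>U\<close>, this information can be added to the colouring of \<open>U\<close> after
  \<open>V\<close> has been tuned, and refining \<open>U\<close> further does not disturb \<open>V\<close>.\<close>

lemma tuned_refinement_union:
  assumes U: "tunable U R" and V: "has_tuned_refinement V R f" and fin: "finite (f ` U)"
    and disj: "U \<inter> V = {}" and oneway: "\<And>x y. x \<in> V \<Longrightarrow> y \<in> U \<Longrightarrow> (x, y) \<notin> R"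
  shows "has_tuned_refinement (U \<union> V) R f"
proof -
  obtain h :: "'a \<Rightarrow> nat" where h: "finite (h ` V)"
    "\<And>x y. x \<in> V \<Longrightarrow> y \<in> V \<Longrightarrow> h x = h y \<Longrightarrow> f x = f y" "tuned V R h"
    using V unfolding has_tuned_refinement_def by blast
  define f' where "f' x = (f x, {h y | y. y \<in> V \<and> (x, y) \<in> R})" for x
  have "f' ` U \<subseteq> f ` U \<times> Pow (h ` V)"
    by (auto simp: f'_def)
  then have "finite (f' ` U)"
    using fin h(1) by (meson finite_Pow_iff finite_SigmaI finite_subset)
  then have "has_tuned_refinement U R f'"
    by (rule tunableD[OF U])
  then obtain g :: "'a \<Rightarrow> nat" where g: "finite (g ` U)"
    "\<And>x y. x \<in> U \<Longrightarrow> y \<in> U \<Longrightarrow> g x = g y \<Longrightarrow> f' x = f' y" "tuned U R g"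
    unfolding has_tuned_refinement_def by blast
  define c where "c x = (if x \<in> U then Inl (g x) else Inr (h x))" for x
  have cU: "c x = Inl (g x)" if "x \<in> U" for x
    using that by (simp add: c_def)
  have cV: "c x = Inr (h x)" if "x \<in> V" for x
    using that disj by (auto simp: c_def)
  have "tuned (U \<union> V) R c"
    unfolding tuned_def
  proof (intro ballI impI)
    fix u u' v assume u: "u \<in> U \<union> V" and u': "u' \<in> U \<union> V" and v: "v \<in> U \<union> V"
      and eq: "c u = c u'" and uv: "(u, v) \<in> R"
    have "u \<in> U \<longleftrightarrow> u' \<in> U"
      using eq by (simp add: c_def split: if_splits)
    then consider "u \<in> U" "u' \<in> U" "v \<in> U" | "u \<in> U" "u' \<in> U" "v \<in> V" | "u \<in> V" "u' \<in> V" "v \<in> V"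
      using u u' v oneway uv by blast
    then show "\<exists>v'\<in>U \<union> V. c v' = c v \<and> (u', v') \<in> R"
    proof cases
      case 1
      then have "g u = g u'"
        using eq by (simp add: cU)
      then obtain v' where "v' \<in> U" "g v' = g v" "(u', v') \<in> R"
        using 1 uv g(3) unfolding tuned_def by blast
      then show ?thesis
        using 1 by (auto simp: cU intro!: bexI[of _ v'])
    next
      case 2
      then have "f' u = f' u'"
        using eq by (intro g(2)) (simp_all add: cU)
      then have "h v \<in> {h y | y. y \<in> V \<and> (u', y) \<in> R}"
        using 2 uv unfolding f'_def by blast
      then obtain v' where "v' \<in> V" "h v' = h v" "(u', v') \<in> R"
        by auto
      then show ?thesis
        using 2 by (auto simp: cV intro!: bexI[of _ v'])
    next
      case 3
      then have "h u = h u'"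
        using eq by (simp add: cV)
      then obtain v' where "v' \<in> V" "h v' = h v" "(u', v') \<in> R"
        using 3 uv h(3) unfolding tuned_def by blast
      then show ?thesis
        using 3 by (auto simp: cV intro!: bexI[of _ v'])
    qed
  qed
  moreover have "c ` (U \<union> V) \<subseteq> Inl ` g ` U \<union> Inr ` h ` V"
    by (auto simp: cU cV)
  then have "finite (c ` (U \<union> V))"
    using g(1) h(1) by (meson finite_UnI finite_imageI finite_subset)
  moreover have "f x = f y" if "x \<in> U \<union> V" "y \<in> U \<union> V" "c x = c y" for x y
    using that g(2)[of x y] h(2)[of x y] by (auto simp: cU cV f'_def)
  ultimately show ?thesis
    by (intro has_tuned_refinementI[of c])
qed

text \<open>The points that belong to a given \<open>V\<close> of the finite family \<open>G\<close> are visible to the colouring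
  \<open>x \<mapsto> {V \<in> G. x \<in> V}\<close>.  Being tuned says exactly that \<open>R\<^sup>-\<^sup>1\<close> maps unions of colour classes
  to unions of colour classes.\<close>

lemma tunable_imp_locally_finite:
  assumes "tunable W R"
  shows "locally_finite (Alg W R)"
  unfolding locally_finite_def finitely_generated_def
proof (intro allI impI, elim conjE exE)
  fix S G assume G: "finite G" "G \<subseteq> elems (Alg W R)" and S: "S = generated_subalgebra (Alg W R) G"
  define f where "f x = {V \<in> G. x \<in> V}" for x
  have "f ` W \<subseteq> Pow G"
    by (auto simp: f_def)
  then have "finite (f ` W)"
    using G(1) by (meson finite_Pow_iff finite_subset)
  then have "has_tuned_refinement W R f"
    by (rule tunableD[OF assms])
  then obtain g :: "'a \<Rightarrow> nat" where g: "finite (g ` W)"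
    "\<And>x y. x \<in> W \<Longrightarrow> y \<in> W \<Longrightarrow> g x = g y \<Longrightarrow> f x = f y" "tuned W R g"
    unfolding has_tuned_refinement_def by blast
  define cls where "cls C = {x \<in> W. g x \<in> C}" for C
  define B where "B = cls ` Pow (g ` W)"
  have union_of_classes: "V \<in> B"
    if "V \<subseteq> W" and closed: "\<And>x y. x \<in> V \<Longrightarrow> y \<in> W \<Longrightarrow> g x = g y \<Longrightarrow> y \<in> V" for V
  proof -
    have "cls (g ` V) \<subseteq> V"
    proof
      fix y assume "y \<in> cls (g ` V)"
      then obtain x where "x \<in> V" "g x = g y" "y \<in> W"
        by (auto simp: cls_def)
      then show "y \<in> V"
        using closed[of x y] by simp
    qed
    moreover have "V \<subseteq> cls (g ` V)" "g ` V \<subseteq> g ` W"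
      using \<open>V \<subseteq> W\<close> by (auto simp: cls_def)
    ultimately show ?thesis
      unfolding B_def by blast
  qed
  have "subalgebra B (Alg W R)"
  proof -
    have "cls {} = {}" "cls (g ` W) = W"
      by (auto simp: cls_def)
    then have "{} \<in> B" "W \<in> B"
      unfolding B_def by blast+
    moreover have "X \<inter> Y \<in> B" "X \<union> Y \<in> B" "W - X \<in> B" if "X \<in> B" "Y \<in> B" for X Y
    proof -
      obtain C D where CD: "X = cls C" "Y = cls D" "C \<subseteq> g ` W" "D \<subseteq> g ` W"
        using \<open>X \<in> B\<close> \<open>Y \<in> B\<close> unfolding B_def by blast
      have "X \<inter> Y = cls (C \<inter> D)" "X \<union> Y = cls (C \<union> D)" "W - X = cls (g ` W - C)"
        by (auto simp: CD cls_def)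
      then show "X \<inter> Y \<in> B" "X \<union> Y \<in> B" "W - X \<in> B"
        using CD(3,4) unfolding B_def by blast+
    qed
    moreover have "{x \<in> W. \<exists>y\<in>V. (x, y) \<in> R} \<in> B" if "V \<in> B" for V
    proof (rule union_of_classes)
      fix x x' assume "x \<in> {x \<in> W. \<exists>y\<in>V. (x, y) \<in> R}" and x': "x' \<in> W" "g x = g x'"
      then obtain y where x: "x \<in> W" and y: "y \<in> V" "(x, y) \<in> R"
        by blast
      obtain C where C: "V = cls C"
        using \<open>V \<in> B\<close> unfolding B_def by blast
      then have "y \<in> W"
        using y(1) by (simp add: cls_def)
      then obtain y' where "y' \<in> W" "g y' = g y" "(x', y') \<in> R"
        using g(3) x x' y(2) unfolding tuned_def by blast
      then show "x' \<in> {x \<in> W. \<exists>y\<in>V. (x, y) \<in> R}"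
        using x'(1) y(1) by (auto simp: C cls_def intro!: bexI[of _ y'])
    qed blast
    moreover have "B \<subseteq> Pow W"
      by (auto simp: B_def cls_def)
    ultimately show ?thesis
      by (simp add: subalgebra_def Alg_def)
  qed
  moreover have "G \<subseteq> B"
  proof
    fix V assume V: "V \<in> G"
    show "V \<in> B"
    proof (rule union_of_classes)
      show "V \<subseteq> W"
        using G(2) V by (auto simp: Alg_def)
      fix x y assume "x \<in> V" "y \<in> W" "g x = g y"
      then have "f x = f y"
        using \<open>V \<subseteq> W\<close> by (intro g(2)) auto
      then show "y \<in> V"
        using V \<open>x \<in> V\<close> unfolding f_def by blast
    qed
  qed
  ultimately have "S \<subseteq> B"
    unfolding S generated_subalgebra_def by blast
  moreover have "finite B"
    using g(1) by (simp add: B_def)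
  ultimately show "finite S"
    by (rule finite_subset)
qed

section \<open>Powers of the natural numbers\<close>

text \<open>The two relations of the theorem, treated at once: only \<open>a < b \<Longrightarrow> r a b\<close> and
  \<open>r a b \<Longrightarrow> a \<le> b\<close> matter.\<close>

definition power_rel :: "nat \<Rightarrow> (nat \<Rightarrow> nat \<Rightarrow> bool) \<Rightarrow> (nat \<Rightarrow> nat) rel" where
  "power_rel n r = {(x, y) \<in> omega_pow n \<times> omega_pow n. \<forall>i<n. r (x i) (y i)}"

definition slab :: "nat \<Rightarrow> nat set \<Rightarrow> nat \<Rightarrow> (nat \<Rightarrow> nat) set" where
  "slab n S k = {x \<in> omega_pow n. \<forall>i<n. i \<notin> S \<longrightarrow> x i < k}"

text \<open>The part where some coordinate in \<open>T\<close> is below \<open>m\<close> is cut off one coordinate at a time.  Each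
  cut is one-way, so that the pieces can be glued by \<open>tuned_refinement_union\<close>.\<close>

lemma tuned_refinement_of_corner:
  assumes mono: "\<And>x y i. (x, y) \<in> R \<Longrightarrow> i \<in> T \<Longrightarrow> x i \<le> (y i :: nat)"
    and "finite T" "finite (f ` W)"
    and "\<And>i. i \<in> T \<Longrightarrow> tunable {x \<in> W. x i < m} R"
    and "has_tuned_refinement {x \<in> W. \<forall>i\<in>T. m \<le> x i} R f"
  shows "has_tuned_refinement W R f"
  using assms(2,3,4,5,1)
proof (induction T arbitrary: W rule: finite_induct)
  case empty
  then show ?case
    by simp
next
  case (insert j T)
  let ?U = "{x \<in> W. x j < m}" and ?V = "{x \<in> W. m \<le> x j}"
  have "has_tuned_refinement ?V R f"
  proof (rule insert.IH)
    show "finite (f ` ?V)"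
      using insert.prems(1) by (rule finite_subset[rotated]) auto
    show "tunable {x \<in> ?V. x i < m} R" if "i \<in> T" for i
      using insert.prems(2)[of i] that by (auto intro: tunable_subset)
    have "{x \<in> ?V. \<forall>i\<in>T. m \<le> x i} = {x \<in> W. \<forall>i\<in>insert j T. m \<le> x i}"
      by auto
    then show "has_tuned_refinement {x \<in> ?V. \<forall>i\<in>T. m \<le> x i} R f"
      using insert.prems(3) by simp
  qed (use insert.prems(4) in auto)
  moreover have "tunable ?U R"
    using insert.prems(2) by simp
  moreover have "finite (f ` ?U)"
    using insert.prems(1) by (rule finite_subset[rotated]) auto
  moreover have "(x, y) \<notin> R" if "x \<in> ?V" "y \<in> ?U" for x y
    using insert.prems(4)[of x y j] that by force
  ultimately have "has_tuned_refinement (?U \<union> ?V) R f"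
    by (intro tuned_refinement_union) auto
  moreover have "?U \<union> ?V = W"
    by auto
  ultimately show ?case
    by simp
qed

text \<open>A colour that is not cofinal is absent beyond some bound, and finitely many such bounds have
  a common upper bound.\<close>

lemma threshold_for_cofinal_colours:
  fixes h :: "('i \<Rightarrow> nat) \<Rightarrow> 'c"
  assumes "finite (h ` W)"
  obtains m where "k \<le> m"
    "\<And>x l. x \<in> W \<Longrightarrow> \<forall>i\<in>S. m \<le> x i \<Longrightarrow> \<exists>y\<in>W. h y = h x \<and> (\<forall>i\<in>S. l \<le> y i)"
proof -
  have "\<forall>c. \<exists>b. (\<exists>x\<in>W. h x = c \<and> (\<forall>i\<in>S. b \<le> x i)) \<longrightarrow> (\<forall>l. \<exists>y\<in>W. h y = c \<and> (\<forall>i\<in>S. l \<le> y i))"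
    by blast
  from choice[OF this] obtain b where b: "\<And>c x l. x \<in> W \<Longrightarrow> h x = c \<Longrightarrow> \<forall>i\<in>S. b c \<le> x i \<Longrightarrow>
      \<exists>y\<in>W. h y = c \<and> (\<forall>i\<in>S. l \<le> y i)"
    by blast
  define m where "m = Max (insert k (b ` h ` W))"
  have fin: "finite (insert k (b ` h ` W))"
    using assms by simp
  have "k \<le> m"
    unfolding m_def using fin by (intro Max_ge) auto
  moreover have "\<exists>y\<in>W. h y = h x \<and> (\<forall>i\<in>S. l \<le> y i)" if "x \<in> W" "\<forall>i\<in>S. m \<le> x i" for x l
  proof (rule b)
    have "b (h x) \<le> m"
      unfolding m_def using fin that(1) by (intro Max_ge) auto
    then show "\<forall>i\<in>S. b (h x) \<le> x i"
      using that(2) by force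
  qed (use that in auto)
  ultimately show ?thesis
    using that by blast
qed

text \<open>On a slab the bounded coordinates have only finitely many values, so they can be made part of
  the colour.  Then which colours of the corner a point of the corner sees depends on its
  colour alone: equal colours agree on the
  bounded coordinates, and on the coordinates in \<open>S\<close> cofinality provides a point of any colour of the
  corner that exceeds the given one strictly.\<close>

lemma tunable_slab:
  assumes strict: "\<And>a b. a < b \<Longrightarrow> r a b" and weak: "\<And>a b. r a b \<Longrightarrow> a \<le> b"
    and "finite S" "S \<subseteq> {..<n}"
  shows "tunable (slab n S k) (power_rel n r)"
  using assms(3,4)
proof (induction S arbitrary: k rule: finite_psubset_induct)
  case (psubset S)
  show ?case
    unfolding tunable_def
  proof (intro allI impI)
    fix f :: "(nat \<Rightarrow> nat) \<Rightarrow> nat" assume fin: "finite (f ` slab n S k)"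
    let ?F = "{..<n} - S"
    define h where "h x = (restrict x ?F, f x)" for x
    have "h ` slab n S k \<subseteq> (?F \<rightarrow>\<^sub>E {..<k}) \<times> f ` slab n S k"
      by (auto simp: h_def slab_def split: if_splits)
    moreover have "finite ((?F \<rightarrow>\<^sub>E {..<k}) \<times> f ` slab n S k)"
      using fin by (intro finite_cartesian_product finite_PiE) auto
    ultimately have fin_h: "finite (h ` slab n S k)"
      by (rule finite_subset)
    obtain m where km: "k \<le> m" and cofinal: "\<And>x l. x \<in> slab n S k \<Longrightarrow> \<forall>i\<in>S. m \<le> x i \<Longrightarrow>
        \<exists>y\<in>slab n S k. h y = h x \<and> (\<forall>i\<in>S. l \<le> y i)"
      using threshold_for_cofinal_colours[OF fin_h, of k S] by blast
    let ?Q = "{x \<in> slab n S k. \<forall>i\<in>S. m \<le> x i}"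
    have "tuned ?Q (power_rel n r) h"
      unfolding tuned_def
    proof (intro ballI impI)
      fix u u' v assume u: "u \<in> ?Q" and u': "u' \<in> ?Q" and v: "v \<in> ?Q"
        and eq: "h u = h u'" and uv: "(u, v) \<in> power_rel n r"
      \<comment> \<open>the new point must exceed \<open>u'\<close> strictly on \<open>S\<close> and stay in the corner\<close>
      define l where "l = Max (insert m ((Suc \<circ> u') ` S))"
      have fin_l: "finite (insert m ((Suc \<circ> u') ` S))"
        using psubset.hyps by simp
      have "m \<le> l"
        unfolding l_def using fin_l by (intro Max_ge) auto
      have u'_l: "u' i < l" if "i \<in> S" for i
      proof -
        have "Suc (u' i) \<le> l"
          unfolding l_def using fin_l that by (intro Max_ge) auto
        then show ?thesis
          by simp
      qed
      obtain v' where v': "v' \<in> slab n S k" "h v' = h v" "\<forall>i\<in>S. l \<le> v' i"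
        using cofinal[of v l] v by blast
      have "r (u' i) (v' i)" if "i < n" for i
      proof (cases "i \<in> S")
        case True
        then show ?thesis
          using u'_l v'(3) strict by (meson less_le_trans)
      next
        case False
        \<comment> \<open>a bounded coordinate is recorded in the colour\<close>
        have agree: "x i = y i" if "h x = h y" for x y
          using that False \<open>i < n\<close> unfolding h_def by (metis DiffI Pair_inject lessThan_iff restrict_apply')
        have "r (u i) (v i)"
          using uv \<open>i < n\<close> by (simp add: power_rel_def)
        then show ?thesis
          using agree[OF eq] agree[OF v'(2)] by simp
      qed
      then have "(u', v') \<in> power_rel n r"
        using u' v'(1) by (simp add: power_rel_def slab_def)
      moreover have "v' \<in> ?Q"
        using v' \<open>m \<le> l\<close> by force
      ultimately show "\<exists>v'\<in>?Q. h v' = h v \<and> (u', v') \<in> power_rel n r"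
        using v'(2) by blast
    qed
    moreover have "finite (h ` ?Q)"
      using fin_h by (rule finite_subset[rotated]) auto
    ultimately have corner: "has_tuned_refinement ?Q (power_rel n r) f"
      by (intro has_tuned_refinementI[of h]) (auto simp: h_def)
    show "has_tuned_refinement (slab n S k) (power_rel n r) f"
    proof (rule tuned_refinement_of_corner[OF _ _ fin _ corner])
      \<comment> \<open>as \<open>k \<le> m\<close>, the bound \<open>m\<close> serves for the old bounded coordinates as well as for \<open>i\<close>\<close>
      show "tunable {x \<in> slab n S k. x i < m} (power_rel n r)" if "i \<in> S" for i
      proof (rule tunable_subset)
        show "tunable (slab n (S - {i}) m) (power_rel n r)"
          using psubset.IH[of "S - {i}" m] psubset.prems that by blast
        show "{x \<in> slab n S k. x i < m} \<subseteq> slab n (S - {i}) m"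
          using km by (force simp: slab_def)
      qed
      show "x i \<le> y i" if "(x, y) \<in> power_rel n r" "i \<in> S" for x y i
        using that psubset.prems weak by (auto simp: power_rel_def)
    qed (fact psubset.hyps)
  qed
qed

lemma locally_finite_power_rel:
  assumes "\<And>a b. a < b \<Longrightarrow> r a b" and "\<And>a b. r a b \<Longrightarrow> a \<le> b"
  shows "locally_finite (Alg (omega_pow n) (power_rel n r))"
proof -
  have "slab n {..<n} 0 = omega_pow n"
    by (auto simp: slab_def)
  then show ?thesis
    using tunable_slab[of r "{..<n}" n 0] assms tunable_imp_locally_finite by auto
qed

theorem theorem1:
  fixes n :: nat
  assumes "n > 0"
  shows "locally_finite (Alg (omega_pow n) (preceq_rel n)) \<and>
         locally_finite (Alg (omega_pow n) (prec_rel n))"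
proof -
  have "preceq_rel n = power_rel n (\<le>)" "prec_rel n = power_rel n (<)"
    by (simp_all add: preceq_rel_def prec_rel_def power_rel_def)
  then show ?thesis
    using locally_finite_power_rel[of "(\<le>)" n] locally_finite_power_rel[of "(<)" n] by simp
qed

end
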